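(* Let $\mu := \prod_{n=0}^\infty m_n$ be the product probability measure on $2^{\mathbb{N}}$ whose marginals $m_n$ on $\{0,1\}$ are given by $$m_n(0) = \tfrac13,\quad m_n(1)=\tfrac23 \quad\text{if } n\equiv 0 \pmod 3,$$ $$m_n(0) = \tfrac23,\quad m_n(1)=\tfrac13 \quad\text{if } n\not\equiv 0 \pmod 3.$$ Let $X\subseteq 2^{\mathbb{N}}$ be the set of binary sequences with infinitely many $1$s, let $f:X\to X$ be the least-deletion map, let $E_f$ be its orbit equivalence relation, and let $\mathfrak{w}$ be the Radon--Nikodym cocycle of $E_f$ with respect to $\mu$. Then $\mathfrak{w}$ oscillates along the forward geodesic of $f$ almost everywhere: for $\mu$-a.e. $x\in X$, $$\limsup_{k\to\infty}\mathfrak{w}_x(f^k(x)) = \infty \quad\text{and}\quad \liminf_{k\to\infty}\mathfrak{w}_x(f^k(x)) = 0.$$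
   Context: Sequences in $2^{\mathbb{N}}=\{0,1\}^{\mathbb{N}}$ are written $x=(x_0,x_1,x_2,\dots)$. $X$ denotes the set of $x\in 2^{\mathbb{N}}$ with infinitely many $1$s. The least-deletion map $f:X\to X$ changes the first $1$ of $x$ to $0$ and leaves all other bits unchanged. The orbit equivalence relation $E_f$ on $X$ is: $x\,E_f\,y$ iff $f^a(x)=f^b(y)$ for some $a,b\ge 0$; it coincides with eventual equality on $X$. The forward geodesic of $x$ is $(x,f(x),f^2(x),\dots)$. A countable Borel equivalence relation $E$ on a standard Borel space $X$ is an equivalence relation with countable classes that is a Borel subset of $X\times X$. A measure $\mu$ is $E$-quasi-invariant if the $E$-saturation of every $\mu$-null set is $\mu$-null. Every product measure on $2^{\mathbb{N}}$ whose marginals are non-trivial (give positive mass to both $0$ and $1$) is $E_f$-quasi-invariant (restricted to $X$). Radon--Nikodym cocycle: if $\mu$ is $E$-quasi-invariant, there is a Borel map $\mathfrak{w}:E\to\mathbb{R}^+=(0,\infty)$, unique up to null sets, with $\mathfrak{w}_x(y)$ (for $x\,E\,y$) thought of as the weight of $y$ relative to $x$, satisfying the cocycle identity $\mathfrak{w}_x(z)=\mathfrak{w}_x(y)\,\mathfrak{w}_y(z)$ and the tilted mass transport principle: for every Borel partial bijection $\gamma$ between Borel subsets of $X$ with $\gamma(x)\,E\,x$ for all $x\in\mathrm{dom}(\gamma)$, and every $\varphi\in L^1(X,\mu)$, $$\int_{\mathrm{im}(\gamma)}\varphi(x)\,d\mu(x)=\int_{\mathrm{dom}(\gamma)}\varphi(\gamma(x))\,\mathfrak{w}_x(\gamma(x))\,d\mu(x).$$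 *)

theory Defs
  imports "HOL-Probability.Probability"
begin

definition infinitely_many_ones :: "(nat \<Rightarrow> bool) set" where
  "infinitely_many_ones = {x. infinite {n. x n}}"

text \<open>On sequences without a \<open>True\<close> the value is irrelevant; only sequences in
  \<^const>\<open>infinitely_many_ones\<close> are ever considered.\<close>

definition least_deletion :: "(nat \<Rightarrow> bool) \<Rightarrow> nat \<Rightarrow> bool" where
  "least_deletion x = x((LEAST n. x n) := False)"

definition orbit_eq_rel :: "'a set \<Rightarrow> ('a \<Rightarrow> 'a) \<Rightarrow> 'a rel" where
  "orbit_eq_rel X f = {(x, y). x \<in> X \<and> y \<in> X \<and> (\<exists>a b. (f ^^ a) x = (f ^^ b) y)}"

text \<open>A Borel bijection between Borel subsets of \<open>M\<close> that moves points within their \<open>E\<close>-class.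
  Only the values of \<open>\<gamma>\<close> on its domain \<open>A\<close> matter. Measurability of the inverse
  is not demanded: on standard Borel spaces it is automatic (Lusin--Souslin).\<close>

definition borel_partial_bij :: "'a rel \<Rightarrow> 'a measure \<Rightarrow> 'a set \<Rightarrow> 'a set \<Rightarrow> ('a \<Rightarrow> 'a) \<Rightarrow> bool" where
  "borel_partial_bij E M A B \<gamma> \<longleftrightarrow>
     A \<in> sets M \<and> B \<in> sets M \<and> bij_betw \<gamma> A B \<and>
     \<gamma> \<in> measurable (restrict_space M A) (restrict_space M B) \<and>
     (\<forall>x\<in>A. (\<gamma> x, x) \<in> E)"

text \<open>\<open>w x y\<close> is the weight of \<open>y\<close> relative to \<open>x\<close>; the values of \<open>w\<close> off \<open>E\<close> are unconstrained.
  Integrability of the right-hand side of the tilted mass transport principle is stated separately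
  because the library integral of a non-integrable function is \<open>0\<close>.\<close>

definition radon_nikodym_cocycle :: "'a rel \<Rightarrow> 'a measure \<Rightarrow> ('a \<Rightarrow> 'a \<Rightarrow> real) \<Rightarrow> bool" where
  "radon_nikodym_cocycle E M w \<longleftrightarrow>
     (\<lambda>(x, y). w x y) \<in> borel_measurable (restrict_space (M \<Otimes>\<^sub>M M) E) \<and>
     (\<forall>(x, y)\<in>E. 0 < w x y) \<and>
     (\<forall>x y z. (x, y) \<in> E \<longrightarrow> (y, z) \<in> E \<longrightarrow> w x z = w x y * w y z) \<and>
     (\<forall>A B \<gamma>. borel_partial_bij E M A B \<gamma> \<longrightarrow>
       (\<forall>\<phi> :: 'a \<Rightarrow> real. integrable M \<phi> \<longrightarrow>
         set_integrable M A (\<lambda>x. \<phi> (\<gamma> x) * w x (\<gamma> x)) \<and>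
         (LINT x:B|M. \<phi> x) = (LINT x:A|M. \<phi> (\<gamma> x) * w x (\<gamma> x))))"

text \<open>The argument of \<^const>\<open>bernoulli_pmf\<close> is the mass of \<open>True\<close>, i.e. of the bit \<open>1\<close>.\<close>

definition marginal :: "nat \<Rightarrow> bool pmf" where
  "marginal n = bernoulli_pmf (if n mod 3 = 0 then 2/3 else 1/3)"

definition product_meas :: "(nat \<Rightarrow> bool) measure" where
  "product_meas = PiM UNIV (\<lambda>n. measure_pmf (marginal n))"

end

theory Submission
  imports Defs
begin

text \<open>For finite \<open>F\<close>, mass transport along the partial bijection that switches the bits in \<open>F\<close> off
  determines \<open>\<ww>\<^sub>x\<close> at the image of almost every \<open>x\<close> as a product of factors \<open>m\<^sub>i(0) / m\<^sub>i(1)\<close>,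
  each of which is \<open>1/2\<close> or \<open>2\<close>. There are countably many \<open>F\<close>, and the forward geodesic of \<open>x\<close>
  passes through the points obtained from \<open>x\<close> by clearing all bits below \<open>3N\<close>; there the weight is
  \<open>2\<close> to the power \<open>S\<^sub>N\<close>, where \<open>S\<close> is the random walk with the i.i.d. bounded increments
  \<open>x\<^sub>3\<^sub>j\<^sub>+\<^sub>1 + x\<^sub>3\<^sub>j\<^sub>+\<^sub>2 - x\<^sub>3\<^sub>j\<close>. These have mean \<open>1/3 + 1/3 - 2/3 = 0\<close> and are not constant, so the
  walk is almost surely unbounded in both directions.\<close>

section \<open>Clearing finitely many bits, and the orbits of \<open>least_deletion\<close>\<close>

definition clear_bits :: "nat set \<Rightarrow> (nat \<Rightarrow> bool) \<Rightarrow> nat \<Rightarrow> bool" where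
  "clear_bits F x = (\<lambda>n. n \<notin> F \<and> x n)"

text \<open>Serves as the inverse of \<open>clear_bits F\<close> on the points that vanish on
  \<open>F\<close>.\<close>

definition fill_bits :: "nat set \<Rightarrow> (nat \<Rightarrow> bool) \<Rightarrow> nat \<Rightarrow> bool" where
  "fill_bits F x = (\<lambda>n. n \<in> F \<or> x n)"

lemma clear_bits_empty [simp]: "clear_bits {} x = x"
  by (simp add: clear_bits_def)

lemma fill_clear_bits: "(\<And>i. i \<in> F \<Longrightarrow> x i) \<Longrightarrow> fill_bits F (clear_bits F x) = x"
  by (auto simp: clear_bits_def fill_bits_def)

lemma clear_fill_bits: "(\<And>i. i \<in> F \<Longrightarrow> \<not> x i) \<Longrightarrow> clear_bits F (fill_bits F x) = x"
  by (auto simp: clear_bits_def fill_bits_def)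

text \<open>Mass transport gives the weight only at points that are 1 throughout \<open>F\<close>.
  This identity replaces an interval of positions by the set of ones of \<open>x\<close> in it,
  where that condition holds.\<close>

lemma clear_bits_ones: "clear_bits {i \<in> F. x i} x = clear_bits F x"
  by (auto simp: clear_bits_def)

lemma clear_bits_infinitely_many_ones [simp]:
  assumes "finite F"
  shows "clear_bits F x \<in> infinitely_many_ones \<longleftrightarrow> x \<in> infinitely_many_ones"
proof -
  have "{n. clear_bits F x n} = {n. x n} - F"
    by (auto simp: clear_bits_def)
  with assms show ?thesis
    by (simp add: infinitely_many_ones_def)
qed

lemma fill_bits_infinitely_many_ones [simp]:
  assumes "finite F"
  shows "fill_bits F x \<in> infinitely_many_ones \<longleftrightarrow> x \<in> infinitely_many_ones"
proof -
  have "{n. fill_bits F x n} = {n. x n} \<union> F"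
    by (auto simp: fill_bits_def)
  with assms show ?thesis
    by (simp add: infinitely_many_ones_def)
qed

text \<open>Each 1 below \<open>m\<close> costs exactly one deletion and each 0 costs none, so the
  number of ones below \<open>m\<close> is the time at which the geodesic has erased everything
  below \<open>m\<close>.\<close>

lemma least_deletion_funpow:
  "(least_deletion ^^ card {n. n < m \<and> x n}) x = clear_bits {..<m} x"
proof (induction m)
  case (Suc m)
  show ?case
  proof (cases "x m")
    case True
    have "{n. n < Suc m \<and> x n} = insert m {n. n < m \<and> x n}"
      using True by (auto simp: less_Suc_eq)
    then have "card {n. n < Suc m \<and> x n} = Suc (card {n. n < m \<and> x n})"
      by simp
    moreover have "least_deletion (clear_bits {..<m} x) = clear_bits {..<Suc m} x"
    proof -
      have "(LEAST n. clear_bits {..<m} x n) = m"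
        using True by (intro Least_equality) (auto simp: clear_bits_def not_less)
      then show ?thesis
        by (auto simp: least_deletion_def clear_bits_def less_Suc_eq fun_eq_iff)
    qed
    ultimately show ?thesis
      by (simp add: Suc.IH)
  next
    case False
    then have "{n. n < Suc m \<and> x n} = {n. n < m \<and> x n}"
      by (auto simp: less_Suc_eq)
    then show ?thesis
      using False by (auto simp: Suc.IH clear_bits_def less_Suc_eq)
  qed
qed simp

text \<open>If \<open>m\<close> bounds \<open>F\<close>, erasing all bits below \<open>m\<close>
  leads from both points to the same point, and by \<open>least_deletion_funpow\<close> each erasure
  is an iterate of \<open>least_deletion\<close>.\<close>

lemma clear_bits_orbit:
  assumes "finite F" "x \<in> infinitely_many_ones"
  shows "(clear_bits F x, x) \<in> orbit_eq_rel infinitely_many_ones least_deletion"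
proof -
  obtain m where m: "F \<subseteq> {..<m}"
    using assms(1) finite_nat_iff_bounded by blast
  let ?y = "clear_bits F x"
  have "clear_bits {..<m} ?y = clear_bits {..<m} x"
    using m by (auto simp: clear_bits_def)
  then have "(least_deletion ^^ card {n. n < m \<and> ?y n}) ?y =
      (least_deletion ^^ card {n. n < m \<and> x n}) x"
    by (simp only: least_deletion_funpow)
  with assms show ?thesis
    unfolding orbit_eq_rel_def by auto
qed

section \<open>Change of variables for Bernoulli product measures\<close>

lemma space_PiM_UNIV_pmf [simp]: "space (PiM UNIV (\<lambda>n. measure_pmf (p n))) = UNIV"
  by (auto simp: space_PiM)

lemma measurable_pmf_PiM:
  assumes "\<And>n. (\<lambda>x. f x n) \<in> measurable M (count_space UNIV)"
  shows "f \<in> measurable M (PiM UNIV (\<lambda>n. measure_pmf (p n)))"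
proof (rule measurable_PiM_single')
  show "(\<lambda>x. f x n) \<in> measurable M (measure_pmf (p n))" for n
    using assms[of n] by simp
qed auto

lemma measurable_PiM_pmf_coord [measurable]:
  "(\<lambda>x. x n) \<in> measurable (PiM UNIV (\<lambda>n. measure_pmf (p n))) (count_space UNIV)"
proof -
  have "(\<lambda>x. x n) \<in> measurable (PiM UNIV (\<lambda>n. measure_pmf (p n))) (measure_pmf (p n))"
    by (rule measurable_component_singleton) simp
  then show ?thesis by simp
qed

text \<open>Fubini after splitting off one coordinate: the full product is the image of the
  \<open>n\<close>-th factor times the remaining product under \<open>X(n := b)\<close>.\<close>

lemma nn_integral_PiM_bernoulli:
  fixes p :: "nat \<Rightarrow> real"
  assumes p: "0 \<le> p n" "p n \<le> 1"
  defines "M \<equiv> \<lambda>n. measure_pmf (bernoulli_pmf (p n))"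
  assumes g: "g \<in> borel_measurable (PiM UNIV M)"
  shows "(\<integral>\<^sup>+x. g x \<partial>PiM UNIV M) =
    ennreal (p n) * (\<integral>\<^sup>+X. g (X(n := True)) \<partial>PiM (UNIV - {n}) M) +
    ennreal (1 - p n) * (\<integral>\<^sup>+X. g (X(n := False)) \<partial>PiM (UNIV - {n}) M)"
proof -
  let ?N = "PiM (UNIV - {n}) M"
  have ps: "prob_space (M i)" for i
    unfolding M_def by (rule prob_space_measure_pmf)
  interpret N: prob_space ?N
    by (intro prob_space_PiM ps)
  have eq: "PiM UNIV M = distr (M n \<Otimes>\<^sub>M ?N) (PiM UNIV M) (\<lambda>(b, X). X(n := b))"
    using distr_pair_PiM_eq_PiM[of "UNIV - {n}" M n, OF ps ps] by simp
  have upd: "(\<lambda>(b, X). X(n := b)) \<in> measurable (M n \<Otimes>\<^sub>M ?N) (PiM UNIV M)"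
    unfolding split_beta by (rule measurable_fun_upd[where J="UNIV - {n}"]) auto
  have "(\<integral>\<^sup>+x. g x \<partial>PiM UNIV M) = (\<integral>\<^sup>+z. g ((\<lambda>(b, X). X(n := b)) z) \<partial>(M n \<Otimes>\<^sub>M ?N))"
    using g by (subst eq, subst nn_integral_distr[OF upd]) auto
  also have "\<dots> = (\<integral>\<^sup>+b. (\<integral>\<^sup>+X. g (X(n := b)) \<partial>?N) \<partial>M n)"
    using N.nn_integral_fst[OF measurable_compose[OF upd g]] by simp
  also have "\<dots> = (\<integral>\<^sup>+b. (\<integral>\<^sup>+X. g (X(n := b)) \<partial>?N) * ennreal (pmf (bernoulli_pmf (p n)) b)
      \<partial>count_space UNIV)"
    unfolding M_def by (simp add: nn_integral_measure_pmf mult.commute)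
  finally show ?thesis
    using p by (simp add: nn_integral_count_space_finite UNIV_bool mult.commute add.commute)
qed

text \<open>Once coordinate \<open>n\<close> is split off, both sides contain the same integral over
  the other coordinates, weighted by \<open>1 - p n\<close> on the left and by \<open>p n\<close> on
  the right.\<close>

lemma nn_integral_clear_bit:
  fixes p :: "nat \<Rightarrow> real"
  assumes p: "0 < p n" "p n < 1"
  defines "M \<equiv> PiM UNIV (\<lambda>n. measure_pmf (bernoulli_pmf (p n)))"
  assumes g [measurable]: "g \<in> borel_measurable M"
  shows "(\<integral>\<^sup>+x. indicator {x. \<not> x n} x * g x \<partial>M) =
    ennreal ((1 - p n) / p n) * (\<integral>\<^sup>+x. indicator {x. x n} x * g (x(n := False)) \<partial>M)"
proof -
  let ?N = "PiM (UNIV - {n}) (\<lambda>n. measure_pmf (bernoulli_pmf (p n)))"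
  let ?I = "\<integral>\<^sup>+X. g (X(n := False)) \<partial>?N"
  have [measurable]: "(\<lambda>x. x n) \<in> measurable M (count_space UNIV)" for n
    unfolding M_def by measurable
  have [measurable]: "(\<lambda>x. x(n := False)) \<in> measurable M M"
    unfolding M_def by (rule measurable_pmf_PiM) (simp add: fun_upd_def M_def[symmetric])
  have meas: "(\<lambda>x. indicator {x. \<not> x n} x * g x) \<in> borel_measurable M"
      "(\<lambda>x. indicator {x. x n} x * g (x(n := False))) \<in> borel_measurable M"
    by measurable
  have "(\<integral>\<^sup>+x. indicator {x. \<not> x n} x * g x \<partial>M) = ennreal (1 - p n) * ?I"
    using nn_integral_PiM_bernoulli[of p n, folded M_def, OF _ _ meas(1)] p by simp
  moreover have "(\<integral>\<^sup>+x. indicator {x. x n} x * g (x(n := False)) \<partial>M) = ennreal (p n) * ?I"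
    using nn_integral_PiM_bernoulli[of p n, folded M_def, OF _ _ meas(2)] p by simp
  moreover have "ennreal ((1 - p n) / p n) * ennreal (p n) = ennreal (1 - p n)"
    using p by (subst ennreal_mult[symmetric]) auto
  ultimately show ?thesis
    by (simp add: mult.assoc[symmetric])
qed

text \<open>Bits are cleared one at a time. The induction keeps \<open>g\<close> arbitrary because
  clearing \<open>n\<close> first leaves a new integrand, which carries the condition that bit
  \<open>n\<close> is 1, for the remaining set.\<close>

lemma nn_integral_clear_bits:
  fixes p :: "nat \<Rightarrow> real"
  assumes p: "\<And>n. 0 < p n" "\<And>n. p n < 1" and "finite F"
  defines "M \<equiv> PiM UNIV (\<lambda>n. measure_pmf (bernoulli_pmf (p n)))"
  assumes "g \<in> borel_measurable M"
  shows "(\<integral>\<^sup>+x. indicator {x. \<forall>i\<in>F. \<not> x i} x * g x \<partial>M) =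
    ennreal (\<Prod>i\<in>F. (1 - p i) / p i) *
      (\<integral>\<^sup>+x. indicator {x. \<forall>i\<in>F. x i} x * g (clear_bits F x) \<partial>M)"
  using assms(3,5)
proof (induction F arbitrary: g)
  case (insert n F)
  note [measurable] = insert.prems
  have [measurable]: "(\<lambda>x. x n) \<in> measurable M (count_space UNIV)" for n
    unfolding M_def by measurable
  have [measurable]: "(\<lambda>x. x(n := False)) \<in> measurable M M"
    unfolding M_def by (rule measurable_pmf_PiM) (simp add: fun_upd_def M_def[symmetric])
  have m1: "(\<lambda>x. indicator {x. \<forall>i\<in>F. \<not> x i} x * g x) \<in> borel_measurable M"
    using insert.hyps(1) by measurable
  have m2: "(\<lambda>x. indicator {x. x n} x * g (x(n := False))) \<in> borel_measurable M"
    by measurable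
  have "(\<integral>\<^sup>+x. indicator {x. \<forall>i\<in>insert n F. \<not> x i} x * g x \<partial>M) =
      (\<integral>\<^sup>+x. indicator {x. \<not> x n} x * (indicator {x. \<forall>i\<in>F. \<not> x i} x * g x) \<partial>M)"
    by (intro nn_integral_cong) (simp split: split_indicator)
  also have "\<dots> = ennreal ((1 - p n) / p n) * (\<integral>\<^sup>+x. indicator {x. x n} x *
      (indicator {x. \<forall>i\<in>F. \<not> x i} (x(n := False)) * g (x(n := False))) \<partial>M)"
    using nn_integral_clear_bit[of p n, folded M_def, OF p m1] .
  also have "(\<integral>\<^sup>+x. indicator {x. x n} x *
      (indicator {x. \<forall>i\<in>F. \<not> x i} (x(n := False)) * g (x(n := False))) \<partial>M) =
      (\<integral>\<^sup>+x. indicator {x. \<forall>i\<in>F. \<not> x i} x * (indicator {x. x n} x * g (x(n := False))) \<partial>M)"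
    using insert.hyps(2) by (intro nn_integral_cong) (auto split: split_indicator)
  also have "\<dots> = ennreal (\<Prod>i\<in>F. (1 - p i) / p i) *
      (\<integral>\<^sup>+x. indicator {x. \<forall>i\<in>F. x i} x * (indicator {x. x n} (clear_bits F x) *
        g ((clear_bits F x)(n := False))) \<partial>M)"
    by (rule insert.IH[OF m2])
  also have "(\<integral>\<^sup>+x. indicator {x. \<forall>i\<in>F. x i} x * (indicator {x. x n} (clear_bits F x) *
        g ((clear_bits F x)(n := False))) \<partial>M) =
      (\<integral>\<^sup>+x. indicator {x. \<forall>i\<in>insert n F. x i} x * g (clear_bits (insert n F) x) \<partial>M)"
  proof (rule nn_integral_cong)
    fix x
    have "(clear_bits F x)(n := False) = clear_bits (insert n F) x"
      by (auto simp: clear_bits_def fun_eq_iff)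
    moreover have "clear_bits F x n = x n"
      using insert.hyps(2) by (simp add: clear_bits_def)
    ultimately show "indicator {x. \<forall>i\<in>F. x i} x * (indicator {x. x n} (clear_bits F x) *
        g ((clear_bits F x)(n := False))) =
        indicator {x. \<forall>i\<in>insert n F. x i} x * g (clear_bits (insert n F) x)"
      by (simp split: split_indicator)
  qed
  also have "ennreal ((1 - p n) / p n) * (ennreal (\<Prod>i\<in>F. (1 - p i) / p i) * I) =
      ennreal (\<Prod>i\<in>insert n F. (1 - p i) / p i) * I" for I
    using insert.hyps p
    by (simp add: ennreal_mult[symmetric] mult.assoc[symmetric] prod_nonneg less_imp_le)
  finally show ?case .
qed (simp add: clear_bits_def)

section \<open>The given product measure and its cocycle at cleared points\<close>

definition bit_prob :: "nat \<Rightarrow> real" where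
  "bit_prob n = (if n mod 3 = 0 then 2/3 else 1/3)"

lemma bit_prob_bounds: "0 < bit_prob n" "bit_prob n < 1"
  by (auto simp: bit_prob_def)

lemma product_meas_eq: "product_meas = PiM UNIV (\<lambda>n. measure_pmf (bernoulli_pmf (bit_prob n)))"
  by (simp add: product_meas_def marginal_def bit_prob_def)

lemma space_product_meas [simp]: "space product_meas = UNIV"
  by (simp add: product_meas_eq)

lemma measurable_product_meas:
  "(\<And>n. (\<lambda>x. f x n) \<in> measurable M (count_space UNIV)) \<Longrightarrow> f \<in> measurable M product_meas"
  unfolding product_meas_eq by (rule measurable_pmf_PiM)

lemma measurable_product_meas_coord [measurable]:
  "(\<lambda>x. x n) \<in> measurable product_meas (count_space UNIV)"
  unfolding product_meas_eq by (rule measurable_PiM_pmf_coord)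

lemma measurable_clear_bits [measurable]: "clear_bits F \<in> measurable product_meas product_meas"
  by (rule measurable_product_meas) (simp add: clear_bits_def)

lemma measurable_fill_bits [measurable]: "fill_bits F \<in> measurable product_meas product_meas"
  by (rule measurable_product_meas) (simp add: fill_bits_def)

lemma sets_infinitely_many_ones [measurable]: "infinitely_many_ones \<in> sets product_meas"
proof -
  have "infinitely_many_ones = {x \<in> space product_meas. \<forall>m. \<exists>n>m. x n}"
    by (auto simp: infinitely_many_ones_def infinite_nat_iff_unbounded)
  also have "\<dots> \<in> sets product_meas"
    by measurable
  finally show ?thesis .
qed

interpretation product_meas: prob_space product_meas
  unfolding product_meas_eq by (intro prob_space_PiM prob_space_measure_pmf)

text \<open>\<open>clear_bits F\<close> is a partial bijection inside the orbits. Testing mass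
  transport along it on indicators and comparing with \<open>nn_integral_clear_bits\<close> shows
  that the weight and the constant \<open>c\<close> have equal integrals over every measurable part
  of \<open>A\<close>, so they agree almost everywhere on \<open>A\<close>.\<close>

lemma AE_cocycle_clear_bits:
  assumes w: "radon_nikodym_cocycle (orbit_eq_rel infinitely_many_ones least_deletion)
             (restrict_space product_meas infinitely_many_ones) w"
    and F: "finite F"
  shows "AE x in restrict_space product_meas infinitely_many_ones.
    (\<forall>i\<in>F. x i) \<longrightarrow> w x (clear_bits F x) = (\<Prod>i\<in>F. (1 - bit_prob i) / bit_prob i)"
proof -
  define c where "c = (\<Prod>i\<in>F. (1 - bit_prob i) / bit_prob i)"
  have c: "0 \<le> c"
    unfolding c_def using bit_prob_bounds by (intro prod_nonneg) (auto simp: less_imp_le)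
  let ?X = infinitely_many_ones
  define M where "M = restrict_space product_meas ?X"
  have X: "?X \<inter> space product_meas \<in> sets product_meas"
    by simp
  have spM: "space M = ?X"
    by (simp add: M_def space_restrict_space)
  have setsM: "C \<in> sets M \<longleftrightarrow> C \<subseteq> ?X \<and> C \<in> sets product_meas" for C
    unfolding M_def by (subst sets_restrict_space_iff) auto
  have emM: "emeasure M C = emeasure product_meas C" if "C \<in> sets M" for C
    using that unfolding M_def by (intro emeasure_restrict_space) (auto simp: setsM[unfolded M_def])
  interpret M: finite_measure M
    by (rule finite_measureI) (simp add: emM spM setsM[THEN iffD2])
  define A where "A = {x \<in> ?X. \<forall>i\<in>F. x i}"
  define B where "B = {x \<in> ?X. \<forall>i\<in>F. \<not> x i}"
  have A [measurable]: "A \<in> sets M" and B [measurable]: "B \<in> sets M"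
  proof -
    have "A = ?X \<inter> {x \<in> space product_meas. \<forall>i\<in>F. x i}"
        "B = ?X \<inter> {x \<in> space product_meas. \<forall>i\<in>F. \<not> x i}"
      by (auto simp: A_def B_def)
    moreover have "{x \<in> space product_meas. \<forall>i\<in>F. x i} \<in> sets product_meas"
        "{x \<in> space product_meas. \<forall>i\<in>F. \<not> x i} \<in> sets product_meas"
      using F by measurable
    ultimately show "A \<in> sets M" "B \<in> sets M"
      unfolding setsM by auto
  qed
  have fill: "fill_bits F \<in> measurable M M"
    unfolding M_def using F
    by (intro measurable_restrict_space3) auto
  have "clear_bits F \<in> measurable (restrict_space M A) (restrict_space M B)"
  proof (rule measurable_restrict_space3)
    show "clear_bits F \<in> measurable M M"
      unfolding M_def using F by (intro measurable_restrict_space3) auto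
    show "clear_bits F \<in> A \<rightarrow> B"
      using F by (auto simp: A_def B_def) (auto simp: clear_bits_def)
  qed
  moreover have "bij_betw (clear_bits F) A B"
    by (rule bij_betw_byWitness[where f' = "fill_bits F"])
      (use F in \<open>auto simp: A_def B_def fill_clear_bits clear_fill_bits\<close>,
        auto simp: clear_bits_def fill_bits_def)
  ultimately have "borel_partial_bij (orbit_eq_rel ?X least_deletion) M A B (clear_bits F)"
    unfolding borel_partial_bij_def using A B F clear_bits_orbit by (auto simp: A_def)
  with w have mtp: "set_integrable M A (\<lambda>x. \<phi> (clear_bits F x) * w x (clear_bits F x)) \<and>
         (LINT x:B|M. \<phi> x) = (LINT x:A|M. \<phi> (clear_bits F x) * w x (clear_bits F x))"
    if "integrable M \<phi>" for \<phi>
    unfolding radon_nikodym_cocycle_def M_def[symmetric] using that by blast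
  have "AE x in M. indicator A x * w x (clear_bits F x) = c * indicator A x"
  proof (rule density_unique_real)
    \<comment> \<open>Mass transport of the constant function 1 yields the integrability of the
      weight itself.\<close>
    show "integrable M (\<lambda>x. indicator A x * w x (clear_bits F x))"
      using mtp[of "\<lambda>_. 1"] by (simp add: set_integrable_def)
    show "integrable M (\<lambda>x. c * indicator A x)"
      using M.emeasure_finite by (simp add: less_top[symmetric])
    fix C assume C [measurable]: "C \<in> sets M"
    \<comment> \<open>\<open>B \<inter> D\<close> is the image of \<open>A \<inter> C\<close> under
      \<open>clear_bits F\<close>. Writing \<open>D\<close> as a preimage under
      \<open>fill_bits F\<close> gives its measurability directly.\<close>
    define D where "D = fill_bits F -` C \<inter> ?X"
    have D [measurable]: "D \<in> sets M"
      using measurable_sets[OF fill C] by (simp add: D_def spM)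
    have [measurable]: "D \<in> sets product_meas"
      using D setsM by blast
    have AC: "A \<inter> C \<in> sets M" and BD: "B \<inter> D \<in> sets M"
      by measurable
    have D_iff: "clear_bits F x \<in> D \<longleftrightarrow> x \<in> C" if "x \<in> A" for x
      using that F by (auto simp: D_def A_def fill_clear_bits)
    have "emeasure product_meas (B \<inter> D) =
        (\<integral>\<^sup>+x. indicator {x. \<forall>i\<in>F. \<not> x i} x * indicator D x \<partial>product_meas)"
    proof -
      have "emeasure product_meas (B \<inter> D) = (\<integral>\<^sup>+x. indicator (B \<inter> D) x \<partial>product_meas)"
        using BD setsM by (intro nn_integral_indicator[symmetric]) blast
      also have "\<dots> = (\<integral>\<^sup>+x. indicator {x. \<forall>i\<in>F. \<not> x i} x * indicator D x \<partial>product_meas)"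
        by (intro nn_integral_cong) (auto simp: B_def D_def split: split_indicator)
      finally show ?thesis .
    qed
    also have "\<dots> = ennreal c * (\<integral>\<^sup>+x. indicator {x. \<forall>i\<in>F. x i} x *
        indicator D (clear_bits F x) \<partial>product_meas)"
      unfolding c_def product_meas_eq
      by (intro nn_integral_clear_bits bit_prob_bounds F)
        (simp add: product_meas_eq[symmetric])
    also have "(\<integral>\<^sup>+x. indicator {x. \<forall>i\<in>F. x i} x *
        indicator D (clear_bits F x) \<partial>product_meas) = emeasure product_meas (A \<inter> C)"
    proof -
      have "(\<integral>\<^sup>+x. indicator {x. \<forall>i\<in>F. x i} x * indicator D (clear_bits F x) \<partial>product_meas) =
          (\<integral>\<^sup>+x. indicator (A \<inter> C) x \<partial>product_meas)"
      proof (rule nn_integral_cong)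
        fix x
        have "clear_bits F x \<in> D \<Longrightarrow> x \<in> ?X"
          using F by (simp add: D_def)
        then show "indicator {x. \<forall>i\<in>F. x i} x * indicator D (clear_bits F x) =
            (indicator (A \<inter> C) x :: ennreal)"
          using D_iff[of x] by (auto simp: A_def split: split_indicator)
      qed
      also have "\<dots> = emeasure product_meas (A \<inter> C)"
        using AC setsM by (intro nn_integral_indicator) blast
      finally show ?thesis .
    qed
    finally have meas: "measure M (B \<inter> D) = c * measure M (A \<inter> C)"
      using c by (simp add: measure_def emM[OF AC] emM[OF BD] enn2real_mult)
    have "integrable M (indicator D :: _ \<Rightarrow> real)"
      using M.emeasure_finite by (simp add: less_top[symmetric])
    from mtp[OF this] have "(LINT x:B|M. indicator D x) =
        (LINT x:A|M. indicator D (clear_bits F x) * w x (clear_bits F x))"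
      by simp
    also have "\<dots> = (LINT x:C|M. indicator A x * w x (clear_bits F x))"
      unfolding set_lebesgue_integral_def
      by (intro Bochner_Integration.integral_cong) (auto simp: D_iff split: split_indicator)
    also have "(LINT x:B|M. indicator D x) = (LINT x|M. indicator (B \<inter> D) x)"
      unfolding set_lebesgue_integral_def
      by (intro Bochner_Integration.integral_cong) (auto split: split_indicator)
    also have "\<dots> = measure M (B \<inter> D)"
      using BD sets.sets_into_space[OF BD] by (simp add: Int_absorb2)
    also have "\<dots> = c * (LINT x|M. indicator (A \<inter> C) x)"
      unfolding meas using AC sets.sets_into_space[OF AC] by (simp add: Int_absorb2)
    also have "\<dots> = (LINT x:C|M. c * indicator A x)"
      unfolding set_lebesgue_integral_def Bochner_Integration.integral_mult_right_zero[symmetric]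
      by (intro Bochner_Integration.integral_cong) (auto split: split_indicator)
    finally show "(LINT x:C|M. indicator A x * w x (clear_bits F x)) =
        (LINT x:C|M. c * indicator A x)"
      by simp
  qed
  then show ?thesis
    unfolding M_def[symmetric] c_def[symmetric]
  proof (rule AE_mp, intro AE_I2 impI)
    fix x assume "x \<in> space M" "indicator A x * w x (clear_bits F x) = c * indicator A x"
      "\<forall>i\<in>F. x i"
    then show "w x (clear_bits F x) = c"
      by (simp add: A_def spM)
  qed
qed

text \<open>Clearing a 1 at position \<open>i\<close> multiplies the weight by 1/2 if 3 divides
  \<open>i\<close> and by 2 otherwise, so each block of three positions adds one increment to the
  exponent.\<close>

lemma orbit_weight_walk:
  "(\<Prod>i\<in>{i. i < 3 * N \<and> x i}. (1 - bit_prob i) / bit_prob i) =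
    2 powr (\<Sum>j<N. of_bool (x (3 * j + 1)) + of_bool (x (3 * j + 2)) - of_bool (x (3 * j)))"
proof -
  \<comment> \<open>Giving zeros the factor 1 makes the index range independent of \<open>x\<close>,
    which allows induction on \<open>N\<close>.\<close>
  let ?r = "\<lambda>i. if x i then (1 - bit_prob i) / bit_prob i else 1"
  have "(\<Prod>i\<in>{i. i < 3 * N \<and> x i}. (1 - bit_prob i) / bit_prob i) = (\<Prod>i<3 * N. ?r i)"
    using prod.inter_filter[of "{..<3 * N}" "\<lambda>i. (1 - bit_prob i) / bit_prob i" x] by simp
  also have "\<dots> =
      2 powr (\<Sum>j<N. of_bool (x (3 * j + 1)) + of_bool (x (3 * j + 2)) - of_bool (x (3 * j)))"
  proof (induction N)
    case (Suc N)
    have "3 * N mod 3 = 0" "Suc (3 * N) mod 3 = 1" "Suc (Suc (3 * N)) mod 3 = 2"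
      by presburger+
    then have r: "?r (3 * N) = 2 powr (- of_bool (x (3 * N)))"
        "?r (3 * N + 1) = 2 powr of_bool (x (3 * N + 1))"
        "?r (3 * N + 2) = 2 powr of_bool (x (3 * N + 2))"
      by (simp_all add: bit_prob_def powr_minus)
    have "(\<Prod>i<3 * Suc N. ?r i) =
        (\<Prod>i<3 * N. ?r i) * ?r (3 * N) * ?r (3 * N + 1) * ?r (3 * N + 2)"
      by (simp add: numeral_3_eq_3 del: of_nat_Suc)
    then show ?case
      unfolding Suc.IH r by (simp add: powr_add[symmetric] algebra_simps)
  qed simp
  finally show ?thesis .
qed

section \<open>Unbounded random walks from the central limit theorem\<close>

text \<open>The density is positive everywhere, so a null upper tail would make an interval of
  length 1 Lebesgue null. The strict inequality is what leaves a positive limiting probability for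
  large partial sums.\<close>

lemma std_normal_cdf_less_1: "cdf std_normal_distribution a < 1"
proof -
  interpret real_distribution std_normal_distribution
    by (rule real_dist_normal_dist)
  have "prob {a<..} \<noteq> 0"
  proof
    assume "prob {a<..} = 0"
    then have "{a<..} \<in> null_sets std_normal_distribution"
      by (simp add: null_sets_def emeasure_eq_measure)
    then have "AE x in lborel. x \<in> {a<..} \<longrightarrow> ennreal (std_normal_density x) = 0"
      by (subst (asm) null_sets_density_iff) auto
    then have "AE x in lborel. x \<notin> {a<..}"
      by eventually_elim
        (metis ennreal_eq_0_iff normal_density_pos not_le zero_less_one)
    then have "{a<..} \<in> null_sets lborel"
      by (subst (asm) AE_iff_null_sets[symmetric]) auto
    then have "{a<..<a+1} \<in> null_sets lborel"
      by (rule null_sets_subset) auto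
    then show False
      by (simp add: null_sets_def)
  qed
  then have "prob {a<..} > 0"
    by (simp add: less_le)
  moreover have "prob (space std_normal_distribution - {a<..}) = 1 - prob {a<..}"
    by (rule prob_compl) simp
  moreover have "space std_normal_distribution - {a<..} = {..a}"
    by auto
  ultimately show ?thesis
    by (simp add: cdf_def)
qed

text \<open>Weak convergence controls distribution functions only at continuity points of the limit;
  here every point is one, since singletons are null.\<close>

lemma std_normal_isCont_cdf: "isCont (cdf std_normal_distribution) a"
proof -
  interpret real_distribution std_normal_distribution
    by (rule real_dist_normal_dist)
  have "AE x in lborel. x \<in> {a} \<longrightarrow> ennreal (std_normal_density x) = 0"
    using AE_lborel_singleton[of a] by eventually_elim simp
  then have "{a} \<in> null_sets std_normal_distribution"
    by (subst null_sets_density_iff) auto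
  then show ?thesis
    by (simp add: isCont_cdf measure_eq_0_null_sets)
qed

text \<open>By the central limit theorem the partial sums exceed \<open>\<sigma> \<surd>n\<close> infinitely often with
  positive probability; unboundedness is a tail event, so Kolmogorov's 0-1 law applies.\<close>

lemma (in prob_space) AE_iid_sum_unbounded_above:
  fixes X :: "nat \<Rightarrow> 'a \<Rightarrow> real"
  assumes indep: "indep_vars (\<lambda>i. borel) X UNIV"
    and mean: "\<And>n. expectation (X n) = 0"
    and "\<sigma> > 0"
    and sq: "\<And>n. integrable M (\<lambda>x. (X n x)\<^sup>2)"
    and var: "\<And>n. variance (X n) = \<sigma>\<^sup>2"
    and distr: "\<And>n. distr M borel (X n) = \<mu>"
  shows "AE x in M. \<forall>c n0. \<exists>n\<ge>n0. c < (\<Sum>i<n. X i x)"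
proof -
  have X [measurable]: "X i \<in> borel_measurable M" for i
    using indep by (auto simp: indep_vars_def)
  \<comment> \<open>The bound \<open>c\<close> ranges over the naturals so that only countable
    quantifiers occur and \<open>U\<close> is measurable; real bounds are recovered at the
    end.\<close>
  define U where "U = {x \<in> space M. \<forall>(c::nat) n0. \<exists>n\<ge>n0. real c < (\<Sum>i<n. X i x)}"
  have U [measurable]: "U \<in> events"
    unfolding U_def by measurable
  have "prob U = 0 \<or> prob U = 1"
  proof (rule kolmogorov_0_1_law)
    let ?A = "\<lambda>i. sigma_sets (space M) {X i -` A \<inter> space M |A. A \<in> sets borel}"
    show "sigma_algebra (space M) (?A i)" for i
      by (rule sigma_algebra_sigma_sets) auto
    show "indep_sets ?A UNIV"
      using indep by (simp add: indep_vars_def)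
    show "U \<in> tail_events ?A"
      unfolding tail_events_def
    proof
      fix m
      define N where "N = sigma (space M) (\<Union>(?A ` {m..}))"
      have sub: "\<Union>(?A ` {m..}) \<subseteq> Pow (space M)"
      proof (intro UN_least)
        show "?A i \<subseteq> Pow (space M)" for i
          using sigma_sets_into_sp[of "{X i -` A \<inter> space M |A. A \<in> sets borel}" "space M"] by blast
      qed
      have sets_N: "sets N = sigma_sets (space M) (\<Union>(?A ` {m..}))"
        and space_N: "space N = space M"
        using sub by (simp_all add: N_def)
      have [measurable]: "X i \<in> borel_measurable N" if "i \<ge> m" for i
      proof (rule measurableI)
        fix B :: "real set" assume "B \<in> sets borel"
        then have "X i -` B \<inter> space M \<in> ?A i"
          by auto
        with that show "X i -` B \<inter> space N \<in> sets N"
          unfolding sets_N space_N by (intro sigma_sets.Basic) blast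
      qed simp
      \<comment> \<open>Dropping the first \<open>m\<close> summands shifts all later sums by a
        constant, which an arbitrary bound \<open>c\<close> absorbs. Hence \<open>U\<close> depends
        only on the variables from index \<open>m\<close> on.\<close>
      have "U = {x \<in> space N. \<forall>(c::nat) n0. \<exists>n\<ge>n0. real c < (\<Sum>i\<in>{m..<n}. X i x)}" (is "_ = ?V")
      proof -
        have "(\<forall>(c::nat) n0. \<exists>n\<ge>n0. real c < (\<Sum>i<n. f i)) \<longleftrightarrow>
            (\<forall>(c::nat) n0. \<exists>n\<ge>n0. real c < (\<Sum>i\<in>{m..<n}. f i))" for f :: "nat \<Rightarrow> real"
        proof -
          have split: "(\<Sum>i<n. f i) = (\<Sum>i<m. f i) + (\<Sum>i\<in>{m..<n}. f i)" if "n \<ge> m" for n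
            using that by (metis sum.atLeastLessThan_concat atLeast0LessThan le0)
          show ?thesis
          proof (intro iffI allI)
            fix c n0 :: nat
            assume *: "\<forall>(c::nat) n0. \<exists>n\<ge>n0. real c < (\<Sum>i<n. f i)"
            obtain c' where c': "real c + (\<Sum>i<m. f i) \<le> real c'"
              using real_arch_simple by blast
            obtain n where "n \<ge> max n0 m" "real c' < (\<Sum>i<n. f i)"
              using * by blast
            then show "\<exists>n\<ge>n0. real c < (\<Sum>i\<in>{m..<n}. f i)"
              using c' split[of n] by (intro exI[of _ n]) auto
          next
            fix c n0 :: nat
            assume *: "\<forall>(c::nat) n0. \<exists>n\<ge>n0. real c < (\<Sum>i\<in>{m..<n}. f i)"
            obtain c' where c': "real c - (\<Sum>i<m. f i) \<le> real c'"
              using real_arch_simple by blast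
            obtain n where "n \<ge> max n0 m" "real c' < (\<Sum>i\<in>{m..<n}. f i)"
              using * by blast
            then show "\<exists>n\<ge>n0. real c < (\<Sum>i<n. f i)"
              using c' split[of n] by (intro exI[of _ n]) auto
          qed
        qed
        then show ?thesis
          by (simp add: U_def space_N)
      qed
      also have "?V \<in> sets N"
        by measurable
      finally show "U \<in> sigma_sets (space M) (\<Union>(?A ` {m..}))"
        by (simp add: sets_N)
    qed
  qed
  moreover have "prob U > 0"
  proof -
    define G where "G n = {x \<in> space M. \<sigma> * sqrt (real n) < (\<Sum>i<n. X i x)}" for n
    \<comment> \<open>\<open>H m\<close> decreases to the event that infinitely many
      \<open>G n\<close> occur, so a lower bound common to all \<open>prob (H m)\<close> passes to
      the intersection.\<close>
    define H where "H m = (\<Union>n\<in>{m..}. G n)" for m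
    have G [measurable]: "G n \<in> events" for n
      unfolding G_def by measurable
    have H [measurable]: "H n \<in> events" for n
      unfolding H_def by measurable
    have "(\<lambda>n. cdf (distr M borel (\<lambda>x. (\<Sum>i<n. X i x) / sqrt (real n * \<sigma>\<^sup>2))) 1)
        \<longlonglongrightarrow> cdf std_normal_distribution 1"
      using central_limit_theorem_zero_mean[OF indep mean \<open>\<sigma> > 0\<close> sq var distr]
        std_normal_isCont_cdf
      by (auto simp: weak_conv_m_def weak_conv_def)
    then have lim: "(\<lambda>n. 1 - cdf (distr M borel (\<lambda>x. (\<Sum>i<n. X i x) / sqrt (real n * \<sigma>\<^sup>2))) 1)
        \<longlonglongrightarrow> 1 - cdf std_normal_distribution 1"
      by (intro tendsto_intros)
    \<comment> \<open>The condition that \<open>n\<close> be at least 1 keeps the normalising factor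
      nonzero, so that the division can be undone.\<close>
    have le: "1 - cdf (distr M borel (\<lambda>x. (\<Sum>i<n. X i x) / sqrt (real n * \<sigma>\<^sup>2))) 1 \<le> prob (H m)"
      if "n \<ge> max m 1" for m n
    proof -
      have "prob (G n) \<le> prob (H m)"
        using that by (intro finite_measure_mono H) (auto simp: H_def)
      have "cdf (distr M borel (\<lambda>x. (\<Sum>i<n. X i x) / sqrt (real n * \<sigma>\<^sup>2))) 1 =
          prob {x \<in> space M. (\<Sum>i<n. X i x) / sqrt (real n * \<sigma>\<^sup>2) \<le> 1}"
        unfolding cdf_def by (subst measure_distr) (auto intro!: arg_cong[where f=prob])
      also have "{x \<in> space M. (\<Sum>i<n. X i x) / sqrt (real n * \<sigma>\<^sup>2) \<le> 1} = space M - G n"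
        using \<open>\<sigma> > 0\<close> that
        by (auto simp: G_def real_sqrt_mult divide_le_eq not_less mult.commute)
      also have "prob \<dots> = 1 - prob (G n)"
        by (rule prob_compl) simp
      finally show ?thesis
        using \<open>prob (G n) \<le> prob (H m)\<close> by simp
    qed
    have "1 - cdf std_normal_distribution 1 \<le> prob (H m)" for m
      by (rule LIMSEQ_le_const2[OF lim]) (use le in blast)
    moreover have "(\<lambda>m. prob (H m)) \<longlonglongrightarrow> prob (\<Inter>m. H m)"
      using H by (intro finite_Lim_measure_decseq decseq_SucI) (auto simp: H_def intro: Suc_leD)
    ultimately have "1 - cdf std_normal_distribution 1 \<le> prob (\<Inter>m. H m)"
      by (intro LIMSEQ_le_const) auto
    also have "\<dots> \<le> prob U"
    proof (rule finite_measure_mono[OF _ U], rule subsetI)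
      fix x assume x: "x \<in> (\<Inter>m. H m)"
      show "x \<in> U"
        unfolding U_def
      proof (intro CollectI conjI allI)
        show "x \<in> space M"
          using x by (auto simp: H_def G_def)
        fix c n0 :: nat
        \<comment> \<open>From index \<open>k\<close> on, \<open>\<sigma> * sqrt n\<close> is at
          least \<open>c\<close>, so any later occurrence of \<open>G n\<close> beats the bound
          \<open>c\<close>.\<close>
        obtain k where k: "(real c / \<sigma>)\<^sup>2 \<le> real k"
          using real_arch_simple by blast
        have "x \<in> H (max n0 k)"
          using x by blast
        then obtain n where n: "n \<ge> max n0 k" "\<sigma> * sqrt (real n) < (\<Sum>i<n. X i x)"
          by (auto simp: H_def G_def)
        have "real c / \<sigma> \<le> sqrt (real n)"
          using k n(1) by (intro real_le_rsqrt) simp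
        then have "real c \<le> \<sigma> * sqrt (real n)"
          using \<open>\<sigma> > 0\<close> by (simp add: divide_le_eq mult.commute)
        with n show "\<exists>n\<ge>n0. real c < (\<Sum>i<n. X i x)"
          by (intro exI[of _ n]) auto
      qed
    qed
    finally show ?thesis
      using std_normal_cdf_less_1[of 1] by simp
  qed
  ultimately have "AE x in M. x \<in> U"
    by (simp add: prob_eq_1)
  then show ?thesis
  proof (rule AE_mp, intro AE_I2 impI allI)
    fix x c n0 assume "x \<in> U"
    obtain c' :: nat where "c \<le> real c'"
      using real_arch_simple by blast
    moreover obtain n where "n \<ge> n0" "real c' < (\<Sum>i<n. X i x)"
      using \<open>x \<in> U\<close> by (auto simp: U_def)
    ultimately show "\<exists>n\<ge>n0. c < (\<Sum>i<n. X i x)"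
      by (intro exI[of _ n]) auto
  qed
qed

section \<open>The increments of the walk: independence, common law, mean and variance\<close>

abbreviation block_step :: "nat \<Rightarrow> (nat \<Rightarrow> bool) \<Rightarrow> real" where
  "block_step j x \<equiv> of_bool (x (3 * j + 1)) + of_bool (x (3 * j + 2)) - of_bool (x (3 * j))"

text \<open>The coordinates are independent under the product measure, and distinct increments read
  disjoint blocks of them.\<close>

lemma indep_vars_block_step: "product_meas.indep_vars (\<lambda>_. borel) block_step UNIV"
proof -
  let ?M = "\<lambda>n. measure_pmf (marginal n)"
  have ps: "prob_space (?M n)" for n
    by (rule prob_space_measure_pmf)
  have coord: "product_meas.indep_vars ?M (\<lambda>n x. x n) UNIV"
  proof (subst product_meas.indep_vars_iff_distr_eq_PiM')
    show "distr product_meas (PiM UNIV ?M) (\<lambda>x. \<lambda>n\<in>UNIV. x n) =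
        (\<Pi>\<^sub>M n\<in>UNIV. distr product_meas (?M n) (\<lambda>x. x n))"
      unfolding product_meas_def
      by (subst distr_PiM_component[OF ps]) (simp_all add: restrict_def)
  qed (simp_all add: product_meas_def)
  let ?K = "\<lambda>j::nat. {3 * j, 3 * j + 1, 3 * j + 2}"
  have "disjoint_family_on ?K UNIV"
    unfolding disjoint_family_on_def
  proof (intro ballI impI)
    fix i j :: nat assume "i \<noteq> j"
    then have "3 * i + a \<noteq> 3 * j + b" if "a < 3" "b < 3" for a b
      using that by arith
    from this[of 0 0] this[of 0 1] this[of 0 2] this[of 1 0] this[of 1 1] this[of 1 2]
      this[of 2 0] this[of 2 1] this[of 2 2]
    show "?K i \<inter> ?K j = {}"
      by auto
  qed
  then have "product_meas.indep_vars (\<lambda>j. PiM (?K j) ?M) (\<lambda>j x. restrict (\<lambda>n. x n) (?K j)) UNIV"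
    by (intro product_meas.indep_vars_restrict[OF coord]) auto
  \<comment> \<open>An increment reads only its own block, so restricting its argument to that block
    leaves its value unchanged.\<close>
  then have "product_meas.indep_vars (\<lambda>_. borel)
      (\<lambda>j x. block_step j (restrict (\<lambda>n. x n) (?K j))) UNIV"
  proof (rule product_meas.indep_vars_compose2)
    fix j
    have "(\<lambda>y. of_bool (y n) :: real) \<in> borel_measurable (PiM (?K j) ?M)" if "n \<in> ?K j" for n
    proof -
      have "(\<lambda>y. y n) \<in> measurable (PiM (?K j) ?M) (?M n)"
        using that by (rule measurable_component_singleton)
      then show ?thesis
        by (rule measurable_compose) simp
    qed
    then show "block_step j \<in> borel_measurable (PiM (?K j) ?M)"
      by (intro borel_measurable_diff borel_measurable_add) auto
  qed
  then show ?thesis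
    by simp
qed

text \<open>The marginals have period 3, so the shift by \<open>3 * j\<close> preserves the measure,
  and it carries the increment of block 0 to that of block \<open>j\<close>.\<close>

lemma distr_block_step: "distr product_meas borel (block_step j) = distr product_meas borel (block_step 0)"
proof -
  let ?s = "\<lambda>x n. x (n + 3 * j)"
  have "marginal (n + 3 * j) = marginal n" for n
    by (simp add: marginal_def)
  then have s: "distr product_meas product_meas ?s = product_meas"
    using distr_PiM_reindex[of UNIV "\<lambda>n. measure_pmf (marginal n)" "\<lambda>n. n + 3 * j" UNIV]
    by (simp add: product_meas_def prob_space_measure_pmf inj_on_def restrict_def)
  have [measurable]: "?s \<in> measurable product_meas product_meas"
    by (rule measurable_product_meas) simp
  have "distr product_meas borel (block_step 0) =
      distr (distr product_meas product_meas ?s) borel (block_step 0)"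
    by (simp only: s)
  also have "\<dots> = distr product_meas borel (block_step 0 \<circ> ?s)"
    by (rule distr_distr) measurable
  also have "block_step 0 \<circ> ?s = block_step j"
    by (auto simp: fun_eq_iff add.commute)
  finally show ?thesis ..
qed

lemma expectation_bit: "product_meas.expectation (\<lambda>x. of_bool (x n)) = bit_prob n"
proof -
  have "product_meas.expectation (\<lambda>x. of_bool (x n)) =
      (\<integral>b. (of_bool b :: real) \<partial>distr product_meas (measure_pmf (marginal n)) (\<lambda>x. x n))"
    by (subst integral_distr) (simp_all add: product_meas_def)
  also have "distr product_meas (measure_pmf (marginal n)) (\<lambda>x. x n) = measure_pmf (marginal n)"
    unfolding product_meas_def by (rule distr_PiM_component) (auto simp: prob_space_measure_pmf)
  finally show ?thesis
    by (simp add: marginal_def bit_prob_def)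
qed

lemma integrable_bit: "integrable product_meas (\<lambda>x. of_bool (x n) :: real)"
  by (rule product_meas.integrable_const_bound[where B=1]) auto

lemma expectation_block_step: "product_meas.expectation (block_step j) = 0"
proof -
  have "3 * j mod 3 = 0" "(3 * j + 1) mod 3 = 1" "(3 * j + 2) mod 3 = 2"
    by presburger+
  then show ?thesis
    using integrable_bit by (simp add: expectation_bit bit_prob_def)
qed

lemma integrable_block_step_sq: "integrable product_meas (\<lambda>x. (block_step j x)\<^sup>2)"
proof (rule product_meas.integrable_const_bound[where B=4])
  show "AE x in product_meas. norm ((block_step j x)\<^sup>2) \<le> 4"
    by (intro AE_I2) (simp add: of_bool_def)
qed measurable

lemma expectation_block_step_sq:
  "product_meas.expectation (\<lambda>x. (block_step j x)\<^sup>2) =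
    product_meas.expectation (\<lambda>x. (block_step 0 x)\<^sup>2)"
proof -
  have "product_meas.expectation (\<lambda>x. (block_step j x)\<^sup>2) =
      (\<integral>y. y\<^sup>2 \<partial>distr product_meas borel (block_step j))" for j
    by (rule integral_distr[symmetric]) measurable
  from this[of j] this[of 0] show ?thesis
    by (simp only: distr_block_step[of j])
qed

text \<open>The sequences beginning with 0, 1, 1 have positive probability, and on them the first
  increment equals 2.\<close>

lemma expectation_block_step_sq_pos: "0 < product_meas.expectation (\<lambda>x. (block_step 0 x)\<^sup>2)"
proof -
  interpret PP: product_prob_space "\<lambda>n. measure_pmf (marginal n)" UNIV
    by (intro product_prob_spaceI prob_space_measure_pmf)
  \<comment> \<open>The set \<open>{i \<noteq> 0}\<close> is a singleton of a truth value:
    \<open>{False}\<close> at position 0 and \<open>{True}\<close> at positions 1 and 2.\<close>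
  let ?S = "{x \<in> space product_meas. \<forall>i\<in>{0, 1, 2}. x i \<in> {i \<noteq> (0::nat)}}"
  have S: "emeasure product_meas ?S = (\<Prod>i\<in>{0, 1, 2}. emeasure (measure_pmf (marginal i)) {i \<noteq> 0})"
    unfolding product_meas_def by (rule PP.emeasure_PiM_Collect) auto
  have "emeasure product_meas ?S \<noteq> 0"
    unfolding S by (simp add: emeasure_pmf_single marginal_def)
  have "product_meas.expectation (\<lambda>x. (block_step 0 x)\<^sup>2) \<noteq> 0"
  proof
    assume "product_meas.expectation (\<lambda>x. (block_step 0 x)\<^sup>2) = 0"
    then have "AE x in product_meas. (block_step 0 x)\<^sup>2 = 0"
      using integral_nonneg_eq_0_iff_AE[OF integrable_block_step_sq[of 0]] by simp
    then have "AE x in product_meas. \<not> (\<forall>i\<in>{0, 1, 2}. x i \<in> {i \<noteq> (0::nat)})"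
      by eventually_elim (auto simp: numeral_2_eq_2)
    moreover have "?S \<in> sets product_meas"
      by measurable
    ultimately have "emeasure product_meas ?S = 0"
      by (subst (asm) AE_iff_measurable[of ?S]) auto
    with \<open>emeasure product_meas ?S \<noteq> 0\<close> show False ..
  qed
  moreover have "0 \<le> product_meas.expectation (\<lambda>x. (block_step 0 x)\<^sup>2)"
    by (rule integral_nonneg_AE) simp
  ultimately show ?thesis
    by linarith
qed

text \<open>The negated increments are again i.i.d. and centred with the same variance, so
  unboundedness from above, applied to them as well, gives unboundedness from below.\<close>

lemma AE_block_walk_oscillates:
  "AE x in product_meas. \<forall>c n0. (\<exists>n\<ge>n0. c < (\<Sum>j<n. block_step j x)) \<and>
    (\<exists>n\<ge>n0. (\<Sum>j<n. block_step j x) < c)"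
proof -
  define \<sigma> where "\<sigma> = sqrt (product_meas.expectation (\<lambda>x. (block_step 0 x)\<^sup>2))"
  have \<sigma>: "\<sigma> > 0"
    using expectation_block_step_sq_pos by (simp add: \<sigma>_def)
  have sq: "product_meas.expectation (\<lambda>x. (block_step j x)\<^sup>2) = \<sigma>\<^sup>2" for j
    using expectation_block_step_sq[of j] expectation_block_step_sq_pos by (simp add: \<sigma>_def)
  have "AE x in product_meas. \<forall>c n0. \<exists>n\<ge>n0. c < (\<Sum>j<n. block_step j x)"
    by (rule product_meas.AE_iid_sum_unbounded_above[OF indep_vars_block_step expectation_block_step \<sigma>
      integrable_block_step_sq _ distr_block_step])
      (simp only: expectation_block_step diff_0_right sq)
  moreover have "AE x in product_meas. \<forall>c n0. \<exists>n\<ge>n0. c < (\<Sum>j<n. - block_step j x)"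
  proof (rule product_meas.AE_iid_sum_unbounded_above[OF _ _ \<sigma>])
    show "product_meas.indep_vars (\<lambda>_. borel) (\<lambda>j x. - block_step j x) UNIV"
      by (rule product_meas.indep_vars_compose2[OF indep_vars_block_step]) simp
    show mean: "product_meas.expectation (\<lambda>x. - block_step j x) = 0" for j
      by (simp only: integral_minus expectation_block_step minus_zero)
    show "integrable product_meas (\<lambda>x. (- block_step j x)\<^sup>2)" for j
      using integrable_block_step_sq by (simp only: power2_minus)
    show "product_meas.variance (\<lambda>x. - block_step j x) = \<sigma>\<^sup>2" for j
      by (simp only: mean diff_0_right power2_minus sq)
    have "distr product_meas borel (\<lambda>x. - block_step j x) =
        distr (distr product_meas borel (block_step j)) borel uminus" for j
      by (subst distr_distr) (auto simp: comp_def)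
    then show "distr product_meas borel (\<lambda>x. - block_step j x) =
        distr (distr product_meas borel (block_step 0)) borel uminus" for j
      by (simp only: distr_block_step[of j])
  qed
  ultimately show ?thesis
  proof eventually_elim
    case (elim x)
    show ?case
    proof (intro allI conjI)
      fix c n0
      show "\<exists>n\<ge>n0. c < (\<Sum>j<n. block_step j x)"
        using elim(1) by blast
      obtain n where "n \<ge> n0" "- c < (\<Sum>j<n. - block_step j x)"
        using elim(2) by blast
      then show "\<exists>n\<ge>n0. (\<Sum>j<n. block_step j x) < c"
        unfolding sum_negf by (intro exI[of _ n]) simp
    qed
  qed
qed

section \<open>From the walk to the forward geodesic\<close>

text \<open>Ensures that late steps of the walk correspond to late times on the geodesic, as limsup
  and liminf require.\<close>

lemma eventually_card_ones_ge:
  assumes "x \<in> infinitely_many_ones"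
  shows "\<exists>m0. \<forall>m\<ge>m0. k \<le> card {n. n < m \<and> x n}"
proof -
  obtain T where T: "T \<subseteq> {n. x n}" "finite T" "card T = k"
    using assms infinite_arbitrarily_large[of "{n. x n}" k] by (auto simp: infinitely_many_ones_def)
  obtain m0 where "T \<subseteq> {..<m0}"
    using T(2) finite_nat_iff_bounded by blast
  then have "k \<le> card {n. n < m \<and> x n}" if "m \<ge> m0" for m
    using T that by (auto simp: T(3)[symmetric] intro!: card_mono)
  then show ?thesis
    by blast
qed

lemma limsup_eq_infinity_if_frequently_gt:
  fixes u :: "nat \<Rightarrow> real"
  assumes "\<And>c k0. \<exists>k\<ge>k0. c < u k"
  shows "limsup (\<lambda>k. ereal (u k)) = \<infinity>"
proof (rule ccontr)
  assume "limsup (\<lambda>k. ereal (u k)) \<noteq> \<infinity>"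
  then obtain c where "limsup (\<lambda>k. ereal (u k)) < ereal c"
    using ereal_dense2[of "limsup (\<lambda>k. ereal (u k))" \<infinity>] by auto
  then have "eventually (\<lambda>k. ereal (u k) < ereal c) sequentially"
    by (rule Limsup_lessD)
  with assms[of _ c] show False
    by (fastforce simp: eventually_sequentially)
qed

lemma liminf_eq_0_if_frequently_lt:
  fixes u :: "nat \<Rightarrow> real"
  assumes "\<And>k. 0 \<le> u k" "\<And>e k0. 0 < e \<Longrightarrow> \<exists>k\<ge>k0. u k < e"
  shows "liminf (\<lambda>k. ereal (u k)) = 0"
proof (rule antisym)
  show "0 \<le> liminf (\<lambda>k. ereal (u k))"
    using assms(1) by (intro Liminf_bounded) auto
  show "liminf (\<lambda>k. ereal (u k)) \<le> 0"
  proof (rule ccontr)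
    assume "\<not> liminf (\<lambda>k. ereal (u k)) \<le> 0"
    then obtain e where e: "0 < ereal e" "ereal e < liminf (\<lambda>k. ereal (u k))"
      using ereal_dense2[of 0] by (auto simp: not_le zero_ereal_def)
    from e(2) have "eventually (\<lambda>k. ereal e < ereal (u k)) sequentially"
      by (rule less_LiminfD)
    with assms(2)[of e] e(1) show False
      by (fastforce simp: eventually_sequentially)
  qed
qed

theorem theorem4p2:
  fixes w :: "(nat \<Rightarrow> bool) \<Rightarrow> (nat \<Rightarrow> bool) \<Rightarrow> real"
  assumes "radon_nikodym_cocycle (orbit_eq_rel infinitely_many_ones least_deletion)
             (restrict_space product_meas infinitely_many_ones) w"
  shows "AE x in restrict_space product_meas infinitely_many_ones.
           limsup (\<lambda>k. ereal (w x ((least_deletion ^^ k) x))) = \<infinity> \<and>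
           liminf (\<lambda>k. ereal (w x ((least_deletion ^^ k) x))) = 0"
proof -
  let ?M = "restrict_space product_meas infinitely_many_ones"
  let ?S = "\<lambda>N x. \<Sum>j<N. block_step j x"
  \<comment> \<open>There are countably many finite \<open>F\<close>, so one null set serves them
    all; below, \<open>F\<close> may therefore depend on \<open>x\<close>.\<close>
  have "AE x in ?M. \<forall>F\<in>Collect finite. (\<forall>i\<in>F. x i) \<longrightarrow>
      w x (clear_bits F x) = (\<Prod>i\<in>F. (1 - bit_prob i) / bit_prob i)"
    by (subst AE_ball_countable)
      (auto intro!: countable_Collect_finite AE_cocycle_clear_bits[OF assms])
  moreover have "AE x in ?M. \<forall>c n0. (\<exists>n\<ge>n0. c < ?S n x) \<and> (\<exists>n\<ge>n0. ?S n x < c)"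
    using AE_block_walk_oscillates by (subst AE_restrict_space_iff) auto
  moreover have "AE x in ?M. x \<in> infinitely_many_ones"
    by (rule AE_I2) (simp add: space_restrict_space)
  ultimately show ?thesis
  proof eventually_elim
    case (elim x)
    let ?u = "\<lambda>k. w x ((least_deletion ^^ k) x)"
    let ?k = "\<lambda>N. card {n. n < 3 * N \<and> x n}"
    have u: "?u (?k N) = 2 powr ?S N x" for N
    proof -
      have "?u (?k N) = w x (clear_bits {n \<in> {..<3 * N}. x n} x)"
        by (simp only: least_deletion_funpow clear_bits_ones)
      also have "\<dots> = (\<Prod>i\<in>{i. i < 3 * N \<and> x i}. (1 - bit_prob i) / bit_prob i)"
        using elim(1) by simp
      finally show ?thesis
        by (simp only: orbit_weight_walk)
    qed
    have k: "\<exists>N0. \<forall>N\<ge>N0. k0 \<le> ?k N" for k0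
    proof -
      obtain m0 where "\<forall>m\<ge>m0. k0 \<le> card {n. n < m \<and> x n}"
        using eventually_card_ones_ge[OF elim(3)] by blast
      then show ?thesis
        by (intro exI[of _ m0]) auto
    qed
    have "limsup (\<lambda>k. ereal (?u k)) = \<infinity>"
    proof (rule limsup_eq_infinity_if_frequently_gt)
      fix c :: real and k0 :: nat
      obtain N0 where "\<forall>N\<ge>N0. k0 \<le> ?k N"
        using k by blast
      \<comment> \<open>\<open>c\<close> may be nonpositive; \<open>max c 1\<close> keeps the
        logarithm meaningful.\<close>
      moreover obtain N where "N \<ge> N0" "log 2 (max c 1) < ?S N x"
        using elim(2) by blast
      moreover from this have "max c 1 < 2 powr ?S N x"
        by (simp add: log_less_iff)
      ultimately show "\<exists>k\<ge>k0. c < ?u k"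
        using u[of N] by (intro exI[of _ "?k N"]) auto
    qed
    moreover have "liminf (\<lambda>k. ereal (?u k)) = 0"
    proof (rule liminf_eq_0_if_frequently_lt)
      \<comment> \<open>The walk describes the weight only at the times \<open>?k N\<close>. At the
        other times nonnegativity comes from the positivity of the cocycle on the orbit
        relation.\<close>
      show "0 \<le> ?u k" for k
      proof -
        have "(least_deletion ^^ k) x \<in> infinitely_many_ones"
        proof (induction k)
          case (Suc k)
          have "least_deletion y = clear_bits {LEAST n. y n} y" for y
            by (auto simp: least_deletion_def clear_bits_def fun_eq_iff)
          with Suc show ?case
            by simp
        qed (use elim(3) in simp)
        then have "(x, (least_deletion ^^ k) x) \<in> orbit_eq_rel infinitely_many_ones least_deletion"
          using elim(3) unfolding orbit_eq_rel_def
          by (auto intro: exI[of _ k] exI[where x="0::nat"] simp del: funpow.simps)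
            (metis funpow_0)
        then show ?thesis
          using assms by (fastforce simp: radon_nikodym_cocycle_def intro: less_imp_le)
      qed
      fix e :: real and k0 :: nat assume "0 < e"
      obtain N0 where "\<forall>N\<ge>N0. k0 \<le> ?k N"
        using k by blast
      moreover obtain N where "N \<ge> N0" "?S N x < log 2 e"
        using elim(2) by blast
      moreover from this have "2 powr ?S N x < e"
        using \<open>0 < e\<close> by (simp add: less_log_iff)
      ultimately show "\<exists>k\<ge>k0. ?u k < e"
        using u[of N] by (intro exI[of _ "?k N"]) auto
    qed
    ultimately show ?case ..
  qed
qed

end
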